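(* Let $a>0$ be the speed in the problem $\partial_t u+\partial_x(a(x)u)=0$ on $(x_L,x_R)$, $u(t,x_L)=g_L(t)$, $u(0,x)=u_0(x)$. Let $x_L=x_0<x_1<\dots<x_N=x_R$, and let each element $(x_{k-1},x_k)$, $k=1,\dots,N$, carry a (general) SBP discretisation $D^{(k)},M^{(k)},R^{(k)},B$ as defined in the context (the norm $M^{(k)}$ need not be diagonal and the nodes need not include the element boundaries). Let $\vec a^{(k)}$ be the vectors discretising $a$, write $(a_L^{(k)},a_R^{(k)})^T:=R^{(k)}\vec a^{(k)}$, and assume: (1) $a_L^{(k)}>0$ and $a_R^{(k)}>0$ for all $k$; (2) the discretised speed is continuous across elements: $a_R^{(k)}=a_L^{(k+1)}$ for $1\le k\le N-1$; (3) the interpolations at the boundaries of the domain $(x_L,x_R)$ are exact: $a_L^{(1)}=a(x_L)$ and $a_R^{(N)}=a(x_R)$. Consider the semidiscretisation, for $k=1,\dots,N$, $$\partial_t\vec u^{(k)}=-\tfrac12 D\,\underline{\underline{a}}\,\vec u-\tfrac12\underline{\underline{a}}^{*}D\vec u-\tfrac12\underline{\underline{u}}^{*}D\vec a-M^{-1}R^TB\Big(\vec f^{\mathrm{num}}-\tfrac12R\,\underline{\underline{a}}\,\vec u-\tfrac12(R\vec a)\cdot(R\vec u)\Big),$$ where all quantities on the right carry the element index $(k)$, $(R\vec a)\cdot(R\vec u)$ is the componentwise product, and $\vec f^{\mathrm{num},(k)}=(f^{\mathrm{num}}_{k-1},f^{\mathrm{num}}_k)^T$ with $f^{\mathrm{num}}_k$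 the numerical flux at $x_k$, shared by the adjacent elements. Then the edge based central flux is equivalent to the split central flux, and the edge based upwind flux is equivalent to the split upwind flux (all four fluxes as defined in the context). Moreover: - If the upwind flux $f^{\mathrm{num}}=a_-u_-$ is used at the exterior boundaries $x_0$ and $x_N$, the semidiscretisation is both conservative and stable in the sense defined in the context. - If multiple elements are used ($N>1$), the numerical flux at the interior boundaries $x_k$, $1\le k\le N-1$, can be chosen to be the upwind flux $f^{\mathrm{num}}=a_-u_-$ (adding additional dissipation) or the central flux $f^{\mathrm{num}}=\frac{a_-u_-+a_+u_+}{2}$ (without additional dissipation). That is, the contribution of an interior boundary to the rate of change of the energy, $$2(u_+-u_-)f^{\mathrm{num}}(u_-,u_+)-\big(a_+u_+^2-a_-u_-^2\big),$$ is $\le 0$ for the upwind flux and equal to $0$ for the central flux.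
   Context: **SBP discretisation.** On an element $(x_{k-1},x_k)$ a function $u$ is represented in a nodal basis by the vector $\vec u=(u_0,\dots,u_p)^T$ of its values at pairwise different nodes $\xi_0,\dots,\xi_p$. Matrices $D,M\in\mathbb{R}^{(p+1)\times(p+1)}$, $R\in\mathbb{R}^{2\times(p+1)}$ and $B=\operatorname{diag}(-1,1)$ form a ($q$th order, $q\ge 0$) SBP discretisation if: (i) $D$ is exact for polynomials of degree $q$ (it maps nodal values to nodal values of the derivative); in particular $D\vec 1=0$, where $\vec 1=(1,\dots,1)^T$; (ii) $M$ is symmetric and positive definite; (iii) $MD+D^TM=R^TBR$ (SBP property); (iv) $\vec u^TR^TBR\vec v=uv\big|_{x_{k-1}}^{x_k}$ is exact for polynomials $u,v$ of degree $\le r$, where $r\ge q$. $R$ is the interpolation (restriction) operator to the element boundary: $R\vec u=(u_L,u_R)^T$ approximates $(u(x_{k-1}),u(x_k))^T$, and it reproduces constants, $R\vec 1=(1,1)^T$. The operators may differ from element to element. **Multiplication operators.** $\underline{\underline{a}}=\operatorname{diag}(\vec a)$, $\underline{\underline{u}}=\operatorname{diag}(\vec u)$. The $M$-adjoint is $\underline{\underline{u}}^{*}=M^{-1}\underline{\underline{u}}^{T}M$ (same for $\underline{\underline a}$). **Boundary values.** At an interior boundary $x_k$, $u_-:=u_R^{(k)}$, $u_+:=u_L^{(k+1)}$, $a_-:=a_R^{(k)}$, $a_+:=a_L^{(k+1)}$, where $(u_L^{(k)},u_R^{(k)})^T=R^{(k)}\vec u^{(k)}$. **Numerical fluxes.**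 Edge based central: $f^{\mathrm{num}}(u_-,u_+)=a(x)\frac{u_-+u_+}{2}$. Split central: $f^{\mathrm{num}}(u_-,u_+)=\frac{a_-u_-+a_+u_+}{2}$. Edge based upwind: $f^{\mathrm{num}}(u_-,u_+)=a(x)\,u_-$. Split upwind: $f^{\mathrm{num}}(u_-,u_+)=a_-u_-$. In the edge based fluxes the speed $a(x)$ is evaluated at the position $x$ of the boundary where the numerical flux is evaluated; in the split fluxes $a_\pm$ are the interpolated values of the discretised speed from the adjacent cells. At the left exterior boundary the boundary datum is inserted as left state, so the upwind flux is $f^{\mathrm{num}}_0=a_L^{(1)}g_L=a(x_L)g_L$; at the right exterior boundary the upwind flux is $f^{\mathrm{num}}_N=a_R^{(N)}u_R^{(N)}=a(x_R)u_R^{(N)}$. **Conservative.** On each element $\vec 1^TM^{(k)}\partial_t\vec u^{(k)}=-\vec 1^T R^{(k)T}B\vec f^{\mathrm{num},(k)}=f^{\mathrm{num}}_{k-1}-f^{\mathrm{num}}_k$, so that $$\frac{d}{dt}\sum_{k=1}^N\vec 1^TM^{(k)}\vec u^{(k)}=f^{\mathrm{num}}_0-f^{\mathrm{num}}_N=a(x_L)g_L-a(x_R)u_R^{(N)},$$ mimicking $\frac{d}{dt}\int_{x_L}^{x_R}u=a(x_L)g_L-a(x_R)u(x_R)$. **Stable.** With $\|\vec u\|_M^2=\vec u^TM\vec u$, $$\frac{d}{dt}\sum_{k=1}^N\|\vec u^{(k)}\|_{M^{(k)}}^2\le a(x_L)g_L^2-a(x_R)\big(u_R^{(N)}\big)^2-\sum_{k=1}^N\vec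 u^{(k)T}\underline{\underline{u}}^{(k)T}M^{(k)}D^{(k)}\vec a^{(k)},$$ mimicking $\frac{d}{dt}\int_{x_L}^{x_R} u^2=a(x_L)g_L^2-a(x_R)u(x_R)^2-\int_{x_L}^{x_R} u^2\,\partial_xa$. Here $\vec u^{(k)}(t)$ is a differentiable solution of the semidiscretisation, with the upwind flux at the exterior boundaries and, if $N>1$, the upwind or the central flux at each interior boundary.
   Formalization: At interior boundaries (1)-(3) do not force a(x_k)=a_R^(k), so edge based and split fluxes can differ there; their equality is stated for the common discretised speed at x_k, and for the exact speed a(x_k) precisely when a(x_k)=a_R^(k). *)

theory Defs
  imports
    Complex_Main
    "HOL-Computational_Algebra.Polynomial"
    "Jordan_Normal_Form.Matrix"
    "Jordan_Normal_Form.Gauss_Jordan_Elimination"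
begin

section \<open>SBP operators on one element\<close>

text \<open>Vectors and matrices are those of \<^theory>\<open>Jordan_Normal_Form.Matrix\<close>, whose dimensions are
  values and not types: the number of nodes may differ from element to element.\<close>

record sbp_op =
  sbp_p :: nat
  sbp_node :: "nat \<Rightarrow> real"
  sbp_D :: "real mat"
  sbp_M :: "real mat"
  sbp_R :: "real mat"

abbreviation sbp_dim :: "sbp_op \<Rightarrow> nat" where
  "sbp_dim S \<equiv> sbp_p S + 1"

definition bnd_mat :: "real mat" where
  "bnd_mat = mat_diag 2 (\<lambda>i. if i = 0 then -1 else 1)"

definition ones_vec :: "nat \<Rightarrow> real vec" where
  "ones_vec n = vec n (\<lambda>_. 1)"

definition nodal_vec :: "sbp_op \<Rightarrow> real poly \<Rightarrow> real vec" where
  "nodal_vec S P = vec (sbp_dim S) (\<lambda>i. poly P (sbp_node S i))"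

definition pos_def_mat :: "nat \<Rightarrow> real mat \<Rightarrow> bool" where
  "pos_def_mat n A \<longleftrightarrow> (\<forall>v \<in> carrier_vec n. v \<noteq> 0\<^sub>v n \<longrightarrow> v \<bullet> (A *\<^sub>v v) > 0)"

text \<open>\<open>sbp_discretisation q r y z S\<close>: \<open>S\<close> is an SBP discretisation of order \<open>q\<close>
  on the element with end points \<open>y\<close> and \<open>z\<close>, whose boundary term is exact up to degree \<open>r\<close>.
  Neither is \<open>M\<close> required to be diagonal, nor do the nodes have to contain the end points.\<close>

definition sbp_discretisation :: "nat \<Rightarrow> nat \<Rightarrow> real \<Rightarrow> real \<Rightarrow> sbp_op \<Rightarrow> bool" where
  "sbp_discretisation q r y z S \<longleftrightarrow>
     sbp_D S \<in> carrier_mat (sbp_dim S) (sbp_dim S) \<and>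
     sbp_M S \<in> carrier_mat (sbp_dim S) (sbp_dim S) \<and>
     sbp_R S \<in> carrier_mat 2 (sbp_dim S) \<and>
     inj_on (sbp_node S) {0..sbp_p S} \<and>
     (\<forall>P. degree P \<le> q \<longrightarrow> sbp_D S *\<^sub>v nodal_vec S P = nodal_vec S (pderiv P)) \<and>
     transpose_mat (sbp_M S) = sbp_M S \<and>
     pos_def_mat (sbp_dim S) (sbp_M S) \<and>
     sbp_M S * sbp_D S + transpose_mat (sbp_D S) * sbp_M S
       = transpose_mat (sbp_R S) * bnd_mat * sbp_R S \<and>
     q \<le> r \<and>
     (\<forall>U V. degree U \<le> r \<longrightarrow> degree V \<le> r \<longrightarrow>
        nodal_vec S U \<bullet> ((transpose_mat (sbp_R S) * bnd_mat * sbp_R S) *\<^sub>v nodal_vec S V)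
          = poly U z * poly V z - poly U y * poly V y) \<and>
     sbp_R S *\<^sub>v ones_vec (sbp_dim S) = ones_vec 2"

definition left_val :: "sbp_op \<Rightarrow> real vec \<Rightarrow> real" where
  "left_val S v = (sbp_R S *\<^sub>v v) $ 0"

definition right_val :: "sbp_op \<Rightarrow> real vec \<Rightarrow> real" where
  "right_val S v = (sbp_R S *\<^sub>v v) $ 1"

definition mult_op :: "real vec \<Rightarrow> real mat" where
  "mult_op v = mat_diag (dim_vec v) (\<lambda>i. v $ i)"

text \<open>Positive definite matrices are invertible, so in all uses below \<^const>\<open>mat_inverse\<close>
  does not return \<^const>\<open>None\<close>.\<close>

definition inv_mat :: "real mat \<Rightarrow> real mat" where
  "inv_mat A = the (mat_inverse A)"

definition adjoint_wrt :: "real mat \<Rightarrow> real mat \<Rightarrow> real mat" where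
  "adjoint_wrt M A = inv_mat M * transpose_mat A * M"

definition cw_prod :: "real vec \<Rightarrow> real vec \<Rightarrow> real vec" where
  "cw_prod v w = vec (dim_vec v) (\<lambda>i. v $ i * w $ i)"


section \<open>Numerical fluxes\<close>

text \<open>The arguments of the edge based fluxes are the speed at the boundary and the states \<open>u\<^sub>-\<close>, \<open>u\<^sub>+\<close>;
  the arguments of the split fluxes are \<open>a\<^sub>-\<close>, \<open>a\<^sub>+\<close>, \<open>u\<^sub>-\<close>, \<open>u\<^sub>+\<close>, in this order.\<close>

definition edge_central :: "real \<Rightarrow> real \<Rightarrow> real \<Rightarrow> real" where
  "edge_central s um up = s * ((um + up) / 2)"

definition edge_upwind :: "real \<Rightarrow> real \<Rightarrow> real \<Rightarrow> real" where
  "edge_upwind s um up = s * um"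

definition split_central :: "real \<Rightarrow> real \<Rightarrow> real \<Rightarrow> real \<Rightarrow> real" where
  "split_central am ap um up = (am * um + ap * up) / 2"

definition split_upwind :: "real \<Rightarrow> real \<Rightarrow> real \<Rightarrow> real \<Rightarrow> real" where
  "split_upwind am ap um up = am * um"

text \<open>The flux at \<open>x\<^sub>k\<close> for element operators \<open>S\<close>, discretised speeds \<open>av\<close>, interior fluxes \<open>\<phi>\<close>,
  boundary datum \<open>g\<close> and states \<open>w\<close>. It is the upwind flux at both exterior boundaries: at \<open>x\<^sub>0\<close>
  the datum is the left state and the speed is that of the first element, at \<open>x\<^sub>N\<close> no right
  state is needed.\<close>

definition num_flux :: "nat \<Rightarrow> (nat \<Rightarrow> sbp_op) \<Rightarrow> (nat \<Rightarrow> real vec) \<Rightarrow>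
    (nat \<Rightarrow> real \<Rightarrow> real \<Rightarrow> real \<Rightarrow> real \<Rightarrow> real) \<Rightarrow> real \<Rightarrow> (nat \<Rightarrow> real vec) \<Rightarrow> nat \<Rightarrow> real" where
  "num_flux N S av \<phi> g w k =
     (if k = 0 then left_val (S 1) (av 1) * g
      else if k = N then right_val (S N) (av N) * right_val (S N) (w N)
      else \<phi> k (right_val (S k) (av k)) (left_val (S (k + 1)) (av (k + 1)))
               (right_val (S k) (w k)) (left_val (S (k + 1)) (w (k + 1))))"

definition elem_flux :: "nat \<Rightarrow> (nat \<Rightarrow> sbp_op) \<Rightarrow> (nat \<Rightarrow> real vec) \<Rightarrow>
    (nat \<Rightarrow> real \<Rightarrow> real \<Rightarrow> real \<Rightarrow> real \<Rightarrow> real) \<Rightarrow> real \<Rightarrow> (nat \<Rightarrow> real vec) \<Rightarrow> nat \<Rightarrow> real vec" where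
  "elem_flux N S av \<phi> g w k =
     vec_of_list [num_flux N S av \<phi> g w (k - 1), num_flux N S av \<phi> g w k]"

definition interior_energy_rate ::
    "(real \<Rightarrow> real \<Rightarrow> real \<Rightarrow> real \<Rightarrow> real) \<Rightarrow> real \<Rightarrow> real \<Rightarrow> real \<Rightarrow> real \<Rightarrow> real" where
  "interior_energy_rate f am ap um up =
     2 * (up - um) * f am ap um up - (ap * up^2 - am * um^2)"


section \<open>The semidiscretisation\<close>

definition semidisc_rhs :: "sbp_op \<Rightarrow> real vec \<Rightarrow> real vec \<Rightarrow> real vec \<Rightarrow> real vec" where
  "semidisc_rhs S a u f =
     (let D = sbp_D S; M = sbp_M S; R = sbp_R S in
       - ((1/2) \<cdot>\<^sub>v (D *\<^sub>v (mult_op a *\<^sub>v u)))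
       - (1/2) \<cdot>\<^sub>v (adjoint_wrt M (mult_op a) *\<^sub>v (D *\<^sub>v u))
       - (1/2) \<cdot>\<^sub>v (adjoint_wrt M (mult_op u) *\<^sub>v (D *\<^sub>v a))
       - inv_mat M *\<^sub>v (transpose_mat R *\<^sub>v (bnd_mat *\<^sub>v
           (f - (1/2) \<cdot>\<^sub>v (R *\<^sub>v (mult_op a *\<^sub>v u))
              - (1/2) \<cdot>\<^sub>v cw_prod (R *\<^sub>v a) (R *\<^sub>v u)))))"

text \<open>\<open>u k t\<close> is the vector of nodal values on element \<open>k\<close> at time \<open>t\<close>; time derivatives are taken
  componentwise.\<close>

definition solves_semidisc :: "nat \<Rightarrow> (nat \<Rightarrow> sbp_op) \<Rightarrow> (nat \<Rightarrow> real vec) \<Rightarrow>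
    (nat \<Rightarrow> real \<Rightarrow> real \<Rightarrow> real \<Rightarrow> real \<Rightarrow> real) \<Rightarrow> (real \<Rightarrow> real) \<Rightarrow> real set \<Rightarrow>
    (nat \<Rightarrow> real \<Rightarrow> real vec) \<Rightarrow> bool" where
  "solves_semidisc N S av \<phi> g T u \<longleftrightarrow>
     (\<forall>k \<in> {1..N}. \<forall>t \<in> T.
        u k t \<in> carrier_vec (sbp_dim (S k)) \<and>
        (\<forall>i < sbp_dim (S k).
           ((\<lambda>s. u k s $ i) has_real_derivative
              semidisc_rhs (S k) (av k) (u k t) (elem_flux N S av \<phi> (g t) (\<lambda>j. u j t) k) $ i)
           (at t within T)))"

text \<open>Nondegenerate intervals, bounded or not; on these, derivatives within the interval
  are unique.\<close>

definition time_interval :: "real set \<Rightarrow> bool" where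
  "time_interval T \<longleftrightarrow> connected T \<and> (\<exists>s \<in> T. \<exists>t \<in> T. s < t)"

definition conservative :: "nat \<Rightarrow> (nat \<Rightarrow> real) \<Rightarrow> (real \<Rightarrow> real) \<Rightarrow> (nat \<Rightarrow> sbp_op) \<Rightarrow>
    (nat \<Rightarrow> real vec) \<Rightarrow> (nat \<Rightarrow> real \<Rightarrow> real \<Rightarrow> real \<Rightarrow> real \<Rightarrow> real) \<Rightarrow> bool" where
  "conservative N x a S av \<phi> \<longleftrightarrow>
     (\<forall>T g u. time_interval T \<longrightarrow> solves_semidisc N S av \<phi> g T u \<longrightarrow>
       (\<forall>t \<in> T.
          let F = num_flux N S av \<phi> (g t) (\<lambda>j. u j t) in
          (\<forall>k \<in> {1..N}.
             ((\<lambda>s. ones_vec (sbp_dim (S k)) \<bullet> (sbp_M (S k) *\<^sub>v u k s)) has_real_derivative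
                - (ones_vec (sbp_dim (S k)) \<bullet> (transpose_mat (sbp_R (S k)) *\<^sub>v
                     (bnd_mat *\<^sub>v elem_flux N S av \<phi> (g t) (\<lambda>j. u j t) k))))
               (at t within T) \<and>
             - (ones_vec (sbp_dim (S k)) \<bullet> (transpose_mat (sbp_R (S k)) *\<^sub>v
                  (bnd_mat *\<^sub>v elem_flux N S av \<phi> (g t) (\<lambda>j. u j t) k)))
               = F (k - 1) - F k) \<and>
          ((\<lambda>s. \<Sum>k = 1..N. ones_vec (sbp_dim (S k)) \<bullet> (sbp_M (S k) *\<^sub>v u k s))
             has_real_derivative F 0 - F N) (at t within T) \<and>
          F 0 - F N = a (x 0) * g t - a (x N) * right_val (S N) (u N t)))"

definition energy_stable :: "nat \<Rightarrow> (nat \<Rightarrow> real) \<Rightarrow> (real \<Rightarrow> real) \<Rightarrow> (nat \<Rightarrow> sbp_op) \<Rightarrow>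
    (nat \<Rightarrow> real vec) \<Rightarrow> (nat \<Rightarrow> real \<Rightarrow> real \<Rightarrow> real \<Rightarrow> real \<Rightarrow> real) \<Rightarrow> bool" where
  "energy_stable N x a S av \<phi> \<longleftrightarrow>
     (\<forall>T g u. time_interval T \<longrightarrow> solves_semidisc N S av \<phi> g T u \<longrightarrow>
       (\<forall>t \<in> T. \<exists>d.
          ((\<lambda>s. \<Sum>k = 1..N. u k s \<bullet> (sbp_M (S k) *\<^sub>v u k s)) has_real_derivative d)
            (at t within T) \<and>
          d \<le> a (x 0) * (g t)^2 - a (x N) * (right_val (S N) (u N t))^2
              - (\<Sum>k = 1..N. u k t \<bullet> (transpose_mat (mult_op (u k t)) *\<^sub>v
                   (sbp_M (S k) *\<^sub>v (sbp_D (S k) *\<^sub>v av k))))))"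

end

theory Submission
  imports Defs "Jordan_Normal_Form.Determinant"
begin

text \<open>
  Everything follows from testing the semidiscretisation on one element with a vector \<open>w\<close>, that is,
  from computing \<open>w \<bullet> M \<partial>\<^sub>tu\<close>. Summation by parts moves the derivative in the first volume term onto
  \<open>w\<close> and produces a boundary term which cancels the correction \<open>R a u\<close> of the numerical flux, and
  the \<open>M\<close>-adjoints move the multiplications onto \<open>w\<close> (\<open>semidisc_weak_form\<close>).

  For \<open>w = 1\<close> the first term vanishes since \<open>D 1 = 0\<close>. The remaining two volume terms
  \<open>a \<bullet> M D u + u \<bullet> M D a\<close> are, again by summation by parts, the boundary term \<open>(R a) \<cdot> (R u)\<close>, which
  is the other correction of the flux. Only the numerical flux remains, and it telescopes
  over the elements: this is conservation.

  For \<open>w = u\<close> the first two volume terms cancel by symmetry of \<open>M\<close>, so that the energy rate of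
  an element consists of the volume term \<open>- (u u) \<bullet> M D a\<close> and of boundary terms. Collected by
  mesh point, the boundary terms are \<open>2 a\<^sub>L g u\<^sub>L - a\<^sub>L u\<^sub>L\<^sup>2 \<le> a\<^sub>L g\<^sup>2\<close> at the inflow, \<open>- a\<^sub>R u\<^sub>R\<^sup>2\<close> at the
  outflow, and the interior rate \<open>2 (u\<^sub>+ - u\<^sub>-) f - (a\<^sub>+ u\<^sub>+\<^sup>2 - a\<^sub>- u\<^sub>-\<^sup>2)\<close> in between. As the
  discretised speed is continuous, the latter is \<open>- a (u\<^sub>+ - u\<^sub>-)\<^sup>2\<close> for the upwind flux
  and \<open>0\<close> for the central flux.

  The edge based and the split fluxes are linear in the two states, so two of them agree if and
  only if the speeds in front of the states do.
\<close>

section \<open>Inverses of positive definite matrices\<close>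

lemma pos_def_mat_inv_mat:
  assumes M: "M \<in> carrier_mat n n" and pd: "pos_def_mat n M"
  shows "inv_mat M \<in> carrier_mat n n" "M * inv_mat M = 1\<^sub>m n"
proof -
  have "det M \<noteq> 0"
  proof
    assume "det M = 0"
    then obtain v where v: "v \<in> carrier_vec n" "v \<noteq> 0\<^sub>v n" "M *\<^sub>v v = 0\<^sub>v n"
      using det_0_iff_vec_prod_zero_field[OF M] by blast
    then have "v \<bullet> (M *\<^sub>v v) > 0"
      using pd unfolding pos_def_mat_def by blast
    then show False
      using v by simp
  qed
  then have "mat_inverse M \<noteq> None"
    using mat_inverse(1)[OF M, of undefined] det_non_zero_imp_unit[OF M, of undefined] by blast
  then have "mat_inverse M = Some (inv_mat M)"
    by (simp add: inv_mat_def)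
  then show "inv_mat M \<in> carrier_mat n n" "M * inv_mat M = 1\<^sub>m n"
    using mat_inverse(2)[OF M] by blast+
qed

lemma mult_inv_mat_vec:
  assumes M: "M \<in> carrier_mat n n" and pd: "pos_def_mat n M" and v: "v \<in> carrier_vec n"
  shows "M *\<^sub>v (inv_mat M *\<^sub>v v) = v"
  unfolding assoc_mult_mat_vec[OF M pos_def_mat_inv_mat(1)[OF M pd] v, symmetric]
    pos_def_mat_inv_mat(2)[OF M pd]
  by (rule one_mult_mat_vec[OF v])

lemma mult_adjoint_wrt_vec:
  assumes M: "M \<in> carrier_mat n n" and pd: "pos_def_mat n M"
    and A: "A \<in> carrier_mat n n" and v: "v \<in> carrier_vec n"
  shows "M *\<^sub>v (adjoint_wrt M A *\<^sub>v v) = transpose_mat A *\<^sub>v (M *\<^sub>v v)"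
proof -
  note I = pos_def_mat_inv_mat[OF M pd]
  have "adjoint_wrt M A *\<^sub>v v = inv_mat M *\<^sub>v (transpose_mat A *\<^sub>v (M *\<^sub>v v))"
    unfolding adjoint_wrt_def
    using I M A v by (simp add: assoc_mult_mat_vec[of _ n n _ n])
  then show ?thesis
    using mult_inv_mat_vec[OF M pd, of "transpose_mat A *\<^sub>v (M *\<^sub>v v)"] A M v by simp
qed

section \<open>Multiplication operators and boundary terms\<close>

lemma mult_op_carrier:
  "v \<in> carrier_vec n \<Longrightarrow> mult_op v \<in> carrier_mat n n"
  by (auto simp: mult_op_def)

lemma mult_op_vec:
  assumes "v \<in> carrier_vec n" "w \<in> carrier_vec n"
  shows "mult_op v *\<^sub>v w = vec n (\<lambda>i. v $ i * w $ i)"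
  using assms unfolding mult_op_def
  by (intro eq_vecI) (simp_all add: mat_diag_def scalar_prod_def if_distrib[of "\<lambda>c. c * _"] cong: if_cong)

lemma mult_op_ones:
  assumes "v \<in> carrier_vec n"
  shows "mult_op v *\<^sub>v ones_vec n = v"
  using assms by (subst mult_op_vec[of _ n]) (auto simp: ones_vec_def)

lemma bnd_mat_carrier: "bnd_mat \<in> carrier_mat 2 2"
  by (simp add: bnd_mat_def mat_diag_def)

lemma scalar_prod_bnd_mat:
  assumes "v \<in> carrier_vec 2" "w \<in> carrier_vec 2"
  shows "v \<bullet> (bnd_mat *\<^sub>v w) = v $ 1 * w $ 1 - v $ 0 * w $ 0"
proof -
  have *: "{0..<2} = {0, 1::nat}" by auto
  show ?thesis
    using assms
    by (simp add: bnd_mat_def mat_diag_def scalar_prod_def *)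
qed

section \<open>One element\<close>

locale sbp_element =
  fixes q r :: nat and y z :: real and S :: sbp_op
  assumes sbp: "sbp_discretisation q r y z S"
begin

abbreviation (input) "n \<equiv> sbp_dim S"
abbreviation (input) "D \<equiv> sbp_D S"
abbreviation (input) "M \<equiv> sbp_M S"
abbreviation (input) "R \<equiv> sbp_R S"

lemma carriers:
  "D \<in> carrier_mat n n" "M \<in> carrier_mat n n" "R \<in> carrier_mat 2 n"
  using sbp unfolding sbp_discretisation_def by blast+

lemma M_pos_def: "pos_def_mat n M"
  using sbp unfolding sbp_discretisation_def by blast

lemma M_symmetric:
  assumes "v \<in> carrier_vec n" "w \<in> carrier_vec n"
  shows "v \<bullet> (M *\<^sub>v w) = w \<bullet> (M *\<^sub>v v)"
proof -
  have "transpose_mat M = M"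
    using sbp unfolding sbp_discretisation_def by blast
  then have "(M *\<^sub>v v) \<bullet> w = v \<bullet> (M *\<^sub>v w)"
    using transpose_vec_mult_scalar[OF carriers(2) assms(2,1)] by simp
  then show ?thesis
    using assms carriers by (simp add: comm_scalar_prod[of _ n])
qed

lemma D_ones: "D *\<^sub>v ones_vec n = 0\<^sub>v n"
proof -
  have "D *\<^sub>v nodal_vec S [:1:] = nodal_vec S (pderiv [:1:])"
    using sbp unfolding sbp_discretisation_def by (metis degree_pCons_0 le0)
  moreover have "nodal_vec S [:1:] = ones_vec n" "nodal_vec S (pderiv [:1:]) = 0\<^sub>v n"
    by (auto simp: nodal_vec_def ones_vec_def pderiv_pCons)
  ultimately show ?thesis by simp
qed

lemma boundary_vals_ones: "left_val S (ones_vec n) = 1" "right_val S (ones_vec n) = 1"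
proof -
  have "R *\<^sub>v ones_vec n = ones_vec 2"
    using sbp unfolding sbp_discretisation_def by blast
  then show "left_val S (ones_vec n) = 1" "right_val S (ones_vec n) = 1"
    by (simp_all add: left_val_def right_val_def ones_vec_def)
qed

lemma boundary_term:
  assumes w: "w \<in> carrier_vec n" and f: "f \<in> carrier_vec 2"
  shows "w \<bullet> (transpose_mat R *\<^sub>v (bnd_mat *\<^sub>v f)) = right_val S w * f $ 1 - left_val S w * f $ 0"
proof -
  note B = bnd_mat_carrier
  have "w \<bullet> (transpose_mat R *\<^sub>v (bnd_mat *\<^sub>v f)) = (R *\<^sub>v w) \<bullet> (bnd_mat *\<^sub>v f)"
    using transpose_vec_mult_scalar[OF carriers(3) w, of "bnd_mat *\<^sub>v f"] carriers w f B
    by (simp add: comm_scalar_prod[of _ n] comm_scalar_prod[of _ 2])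
  also have "\<dots> = (R *\<^sub>v w) $ 1 * f $ 1 - (R *\<^sub>v w) $ 0 * f $ 0"
    using carriers w f by (intro scalar_prod_bnd_mat) simp_all
  finally show ?thesis by (simp add: left_val_def right_val_def)
qed

text \<open>The matrix identity \<open>MD + D\<^sup>TM = R\<^sup>TBR\<close> as the discrete counterpart of
  \<open>\<integral> w v' + \<integral> w' v = w v |\<close>.\<close>

lemma summation_by_parts:
  assumes w: "w \<in> carrier_vec n" and v: "v \<in> carrier_vec n"
  shows "w \<bullet> (M *\<^sub>v (D *\<^sub>v v)) + (D *\<^sub>v w) \<bullet> (M *\<^sub>v v)
    = right_val S w * right_val S v - left_val S w * left_val S v"
proof -
  note c = carriers bnd_mat_carrier
  have "w \<bullet> (transpose_mat D *\<^sub>v (M *\<^sub>v v)) = (D *\<^sub>v w) \<bullet> (M *\<^sub>v v)"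
    using transpose_vec_mult_scalar[OF carriers(1) w, of "M *\<^sub>v v"] c w v
    by (simp add: comm_scalar_prod[of _ n])
  then have "w \<bullet> (M *\<^sub>v (D *\<^sub>v v)) + (D *\<^sub>v w) \<bullet> (M *\<^sub>v v)
      = w \<bullet> ((M * D + transpose_mat D * M) *\<^sub>v v)"
    using c w v
    by (simp add: add_mult_distrib_mat_vec[of _ n n] assoc_mult_mat_vec[of _ n n _ n]
        scalar_prod_add_distrib[of _ n])
  also have "M * D + transpose_mat D * M = transpose_mat R * bnd_mat * R"
    using sbp unfolding sbp_discretisation_def by blast
  also have "(transpose_mat R * bnd_mat * R) *\<^sub>v v = transpose_mat R *\<^sub>v (bnd_mat *\<^sub>v (R *\<^sub>v v))"
    using c w v
    by (simp add: assoc_mult_mat_vec[of _ n 2 _ n] assoc_mult_mat_vec[of _ n 2 _ 2])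
  finally show ?thesis
    using boundary_term[OF w, of "R *\<^sub>v v"] c v by (simp add: left_val_def right_val_def)
qed

lemma mult_op_adjoint:
  assumes w: "w \<in> carrier_vec n" and a: "a \<in> carrier_vec n" and v: "v \<in> carrier_vec n"
  shows "w \<bullet> (transpose_mat (mult_op a) *\<^sub>v v) = (mult_op a *\<^sub>v w) \<bullet> v"
proof -
  note A = mult_op_carrier[OF a]
  have "transpose_mat (mult_op a) *\<^sub>v v \<in> carrier_vec n" "mult_op a *\<^sub>v w \<in> carrier_vec n"
    using A v w by (meson mult_mat_vec_carrier transpose_carrier_mat)+
  then show ?thesis
    using transpose_vec_mult_scalar[OF A w v] comm_scalar_prod w v by metis
qed

lemma semidisc_rhs_carrier:
  assumes "a \<in> carrier_vec n" "u \<in> carrier_vec n" "f \<in> carrier_vec 2"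
  shows "semidisc_rhs S a u f \<in> carrier_vec n"
proof -
  have "dim_row (inv_mat M) = n"
    using pos_def_mat_inv_mat(1)[OF carriers(2) M_pos_def] by (rule carrier_matD)
  then show ?thesis
    unfolding semidisc_rhs_def Let_def by (intro carrier_vecI) (simp only: index_minus_vec dim_mult_mat_vec)
qed

text \<open>The boundary term which summation by parts creates from \<open>w \<bullet> M D (a u)\<close> is cancelled by
  the correction \<open>R a u / 2\<close> of the flux. The correction has to interpolate the product \<open>a u\<close> for this, since interpolation
  and multiplication do not commute.\<close>

lemma semidisc_weak_form:
  assumes w: "w \<in> carrier_vec n" and a: "a \<in> carrier_vec n" and u: "u \<in> carrier_vec n"
    and f: "f \<in> carrier_vec 2"
  shows "w \<bullet> (M *\<^sub>v semidisc_rhs S a u f) =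
      ((D *\<^sub>v w) \<bullet> (M *\<^sub>v (mult_op a *\<^sub>v u))
        - (mult_op a *\<^sub>v w) \<bullet> (M *\<^sub>v (D *\<^sub>v u))
        - (mult_op u *\<^sub>v w) \<bullet> (M *\<^sub>v (D *\<^sub>v a))) / 2
      - (right_val S w * f $ 1 - left_val S w * f $ 0)
      + (right_val S w * (right_val S a * right_val S u)
        - left_val S w * (left_val S a * left_val S u)) / 2"
proof -
  note c = carriers bnd_mat_carrier
  note Minv = pos_def_mat_inv_mat(1)[OF carriers(2) M_pos_def]
  note A = mult_op_carrier[OF a] and U = mult_op_carrier[OF u]
  define h where "h = f - (1/2) \<cdot>\<^sub>v (R *\<^sub>v (mult_op a *\<^sub>v u))
              - (1/2) \<cdot>\<^sub>v cw_prod (R *\<^sub>v a) (R *\<^sub>v u)"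
  have h: "h \<in> carrier_vec 2"
    using carrier_matD(1)[OF c(3)] by (intro carrier_vecI) (simp add: h_def cw_prod_def)
  have adj: "adjoint_wrt M A \<in> carrier_mat n n" if "A \<in> carrier_mat n n" for A
    using c Minv that by (auto simp: adjoint_wrt_def)
  have lincomb: "v \<bullet> (- ((1/2) \<cdot>\<^sub>v v1) - (1/2) \<cdot>\<^sub>v v2 - (1/2) \<cdot>\<^sub>v v3 - v4)
      = - (v \<bullet> v1) / 2 - (v \<bullet> v2) / 2 - (v \<bullet> v3) / 2 - v \<bullet> v4"
    if "v \<in> carrier_vec n" "v1 \<in> carrier_vec n" "v2 \<in> carrier_vec n" "v3 \<in> carrier_vec n"
      "v4 \<in> carrier_vec n" for v v1 v2 v3 v4 :: "real vec"
    using that by (simp add: scalar_prod_minus_distrib[of _ n])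
  have M_left: "(M *\<^sub>v w) \<bullet> v = w \<bullet> (M *\<^sub>v v)" if "v \<in> carrier_vec n" for v
    using M_symmetric[OF w that] comm_scalar_prod[of "M *\<^sub>v w" n v] c w that by simp
  have carr: "D *\<^sub>v (mult_op a *\<^sub>v u) \<in> carrier_vec n"
    "adjoint_wrt M (mult_op a) *\<^sub>v (D *\<^sub>v u) \<in> carrier_vec n"
    "adjoint_wrt M (mult_op u) *\<^sub>v (D *\<^sub>v a) \<in> carrier_vec n"
    "transpose_mat R *\<^sub>v (bnd_mat *\<^sub>v h) \<in> carrier_vec n"
    "inv_mat M *\<^sub>v (transpose_mat R *\<^sub>v (bnd_mat *\<^sub>v h)) \<in> carrier_vec n"
    "D *\<^sub>v u \<in> carrier_vec n" "D *\<^sub>v a \<in> carrier_vec n" "M *\<^sub>v w \<in> carrier_vec n"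
    "semidisc_rhs S a u f \<in> carrier_vec n"
    using c A U Minv a u w h adj[OF A] adj[OF U] semidisc_rhs_carrier[OF a u f]
    by (meson mult_mat_vec_carrier transpose_carrier_mat)+
  \<comment> \<open>Symmetry moves \<open>M\<close> onto \<open>w\<close>, so that the sum is expanded inside a scalar product, and then
     back onto the single terms, where it cancels \<open>M\<^sup>-\<^sup>1\<close>.\<close>
  have "w \<bullet> (M *\<^sub>v semidisc_rhs S a u f) = (M *\<^sub>v w) \<bullet> semidisc_rhs S a u f"
    by (rule M_left[symmetric]) (rule carr)
  also have "\<dots> =
      - ((M *\<^sub>v w) \<bullet> (D *\<^sub>v (mult_op a *\<^sub>v u))) / 2
      - ((M *\<^sub>v w) \<bullet> (adjoint_wrt M (mult_op a) *\<^sub>v (D *\<^sub>v u))) / 2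
      - ((M *\<^sub>v w) \<bullet> (adjoint_wrt M (mult_op u) *\<^sub>v (D *\<^sub>v a))) / 2
      - (M *\<^sub>v w) \<bullet> (inv_mat M *\<^sub>v (transpose_mat R *\<^sub>v (bnd_mat *\<^sub>v h)))"
    unfolding semidisc_rhs_def Let_def h_def[symmetric] by (rule lincomb) (rule carr)+
  also have "\<dots> =
      - (w \<bullet> (M *\<^sub>v (D *\<^sub>v (mult_op a *\<^sub>v u)))) / 2
      - (w \<bullet> (transpose_mat (mult_op a) *\<^sub>v (M *\<^sub>v (D *\<^sub>v u)))) / 2
      - (w \<bullet> (transpose_mat (mult_op u) *\<^sub>v (M *\<^sub>v (D *\<^sub>v a)))) / 2
      - w \<bullet> (transpose_mat R *\<^sub>v (bnd_mat *\<^sub>v h))"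
    using carr by (simp only: M_left mult_inv_mat_vec[OF c(2) M_pos_def]
        mult_adjoint_wrt_vec[OF c(2) M_pos_def A] mult_adjoint_wrt_vec[OF c(2) M_pos_def U])
  also have "w \<bullet> (transpose_mat R *\<^sub>v (bnd_mat *\<^sub>v h)) =
      right_val S w * f $ 1 - left_val S w * f $ 0
      - (right_val S w * right_val S (mult_op a *\<^sub>v u) - left_val S w * left_val S (mult_op a *\<^sub>v u)) / 2
      - (right_val S w * (right_val S a * right_val S u)
        - left_val S w * (left_val S a * left_val S u)) / 2"
  proof -
    have h_vals: "h $ 0 = f $ 0 - left_val S (mult_op a *\<^sub>v u) / 2 - left_val S a * left_val S u / 2"
      "h $ 1 = f $ 1 - right_val S (mult_op a *\<^sub>v u) / 2 - right_val S a * right_val S u / 2"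
      using c f a u by (simp_all add: h_def cw_prod_def left_val_def right_val_def)
    show ?thesis
      unfolding boundary_term[OF w h] h_vals by (simp add: field_simps)
  qed
  also have "w \<bullet> (transpose_mat (mult_op a) *\<^sub>v (M *\<^sub>v (D *\<^sub>v u))) = (mult_op a *\<^sub>v w) \<bullet> (M *\<^sub>v (D *\<^sub>v u))"
    using c u by (intro mult_op_adjoint w a) simp_all
  also have "w \<bullet> (transpose_mat (mult_op u) *\<^sub>v (M *\<^sub>v (D *\<^sub>v a))) = (mult_op u *\<^sub>v w) \<bullet> (M *\<^sub>v (D *\<^sub>v a))"
    using c a by (intro mult_op_adjoint w u) simp_all
  also have "w \<bullet> (M *\<^sub>v (D *\<^sub>v (mult_op a *\<^sub>v u))) =
      right_val S w * right_val S (mult_op a *\<^sub>v u) - left_val S w * left_val S (mult_op a *\<^sub>v u)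
      - (D *\<^sub>v w) \<bullet> (M *\<^sub>v (mult_op a *\<^sub>v u))"
    using summation_by_parts[OF w, of "mult_op a *\<^sub>v u"] A u by simp
  finally show ?thesis
    by (simp add: field_simps)
qed

text \<open>Testing with \<open>1\<close>: the split form of the product rule is designed so that
  \<open>a \<bullet> M D u + u \<bullet> M D a\<close> reduces to boundary values, which the flux correction removes.\<close>

lemma semidisc_mass_rate:
  assumes a: "a \<in> carrier_vec n" and u: "u \<in> carrier_vec n" and f: "f \<in> carrier_vec 2"
  shows "ones_vec n \<bullet> (M *\<^sub>v semidisc_rhs S a u f) = f $ 0 - f $ 1"
proof -
  note c = carriers
  have one: "ones_vec n \<in> carrier_vec n" by (simp add: ones_vec_def)
  have "(0\<^sub>v n) \<bullet> (M *\<^sub>v (mult_op a *\<^sub>v u)) = 0"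
    by (intro scalar_prod_left_zero mult_mat_vec_carrier[OF c(2)]
        mult_mat_vec_carrier[OF mult_op_carrier[OF a]] u)
  moreover have "u \<bullet> (M *\<^sub>v (D *\<^sub>v a)) = right_val S u * right_val S a - left_val S u * left_val S a
      - a \<bullet> (M *\<^sub>v (D *\<^sub>v u))"
    using summation_by_parts[OF u a] M_symmetric[OF a, of "D *\<^sub>v u"] c u by simp
  ultimately show ?thesis
    unfolding semidisc_weak_form[OF one a u f] boundary_vals_ones D_ones
      mult_op_ones[OF a] mult_op_ones[OF u]
    by argo
qed

text \<open>Testing with \<open>u\<close>: the first two volume terms are \<open>(D u) \<bullet> M (a u)\<close> and its transpose, which
  cancel by symmetry of \<open>M\<close>. It is the adjoint in the scheme that makes them transposes of each
  other: a norm \<open>M\<close> which is not diagonal does not commute with the multiplication by \<open>a\<close>.\<close>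

lemma semidisc_energy_rate:
  assumes a: "a \<in> carrier_vec n" and u: "u \<in> carrier_vec n" and f: "f \<in> carrier_vec 2"
  shows "2 * (u \<bullet> (M *\<^sub>v semidisc_rhs S a u f)) =
      - (u \<bullet> (transpose_mat (mult_op u) *\<^sub>v (M *\<^sub>v (D *\<^sub>v a))))
      + (2 * left_val S u * f $ 0 - left_val S a * (left_val S u)\<^sup>2)
      - (2 * right_val S u * f $ 1 - right_val S a * (right_val S u)\<^sup>2)"
proof -
  note c = carriers
  have "(D *\<^sub>v u) \<bullet> (M *\<^sub>v (mult_op a *\<^sub>v u)) = (mult_op a *\<^sub>v u) \<bullet> (M *\<^sub>v (D *\<^sub>v u))"
    using c u mult_op_carrier[OF a] by (intro M_symmetric) simp_all
  moreover have "u \<bullet> (transpose_mat (mult_op u) *\<^sub>v (M *\<^sub>v (D *\<^sub>v a))) = (mult_op u *\<^sub>v u) \<bullet> (M *\<^sub>v (D *\<^sub>v a))"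
    using c a by (intro mult_op_adjoint u) simp_all
  ultimately show ?thesis
    using semidisc_weak_form[OF u a u f] by (simp add: field_simps power2_eq_square)
qed

end

section \<open>Time derivatives of linear and quadratic functionals\<close>

text \<open>The dimension of \<open>u s\<close> is only controlled for \<open>s\<close> in \<open>T\<close>, so the functionals agree with
  their expansions into components only there.\<close>

lemma has_real_derivative_scalar_prod_mult_mat_vec:
  fixes u w :: "real \<Rightarrow> real vec"
  assumes A: "A \<in> carrier_mat n m"
    and u: "\<And>s. s \<in> T \<Longrightarrow> u s \<in> carrier_vec m"
    and u': "u' \<in> carrier_vec m"
    and dw: "\<And>i. i < n \<Longrightarrow> ((\<lambda>s. w s $ i) has_real_derivative w' $ i) (at t within T)"
    and du: "\<And>j. j < m \<Longrightarrow> ((\<lambda>s. u s $ j) has_real_derivative u' $ j) (at t within T)"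
    and t: "t \<in> T"
  shows "((\<lambda>s. w s \<bullet> (A *\<^sub>v u s)) has_real_derivative w' \<bullet> (A *\<^sub>v u t) + w t \<bullet> (A *\<^sub>v u'))
    (at t within T)"
proof -
  have expand: "v \<bullet> (A *\<^sub>v v') = (\<Sum>i<n. v $ i * (\<Sum>j<m. A $$ (i, j) * v' $ j))"
    if "v' \<in> carrier_vec m" for v v'
    using A that by (simp add: scalar_prod_def atLeast0LessThan)
  have "((\<lambda>s. \<Sum>i<n. w s $ i * (\<Sum>j<m. A $$ (i, j) * u s $ j)) has_real_derivative
      (\<Sum>i<n. w' $ i * (\<Sum>j<m. A $$ (i, j) * u t $ j) + (\<Sum>j<m. A $$ (i, j) * u' $ j) * w t $ i))
    (at t within T)"
    by (intro DERIV_sum DERIV_mult DERIV_cmult dw du) simp_all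
  then have "((\<lambda>s. \<Sum>i<n. w s $ i * (\<Sum>j<m. A $$ (i, j) * u s $ j)) has_real_derivative
      w' \<bullet> (A *\<^sub>v u t) + w t \<bullet> (A *\<^sub>v u')) (at t within T)"
    using u u' t by (simp add: expand sum.distrib mult.commute)
  then show ?thesis
    by (rule has_field_derivative_transform_within[where d = 1]) (use u t in \<open>simp_all add: expand\<close>)
qed

section \<open>Interior boundaries\<close>

lemma interior_energy_rate_split_upwind:
  "interior_energy_rate split_upwind s s um up = - s * (up - um)\<^sup>2"
  by (simp add: interior_energy_rate_def split_upwind_def power2_eq_square algebra_simps)

lemma interior_energy_rate_split_central:
  "interior_energy_rate split_central s s um up = 0"
  by (simp add: interior_energy_rate_def split_central_def power2_eq_square field_simps)

text \<open>Summation over the elements, regrouped by mesh points: \<open>L k\<close> is what element \<open>k\<close>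
  receives at its left end, \<open>Q k\<close> what it loses at its right end.\<close>

lemma sum_left_minus_right:
  fixes L Q :: "nat \<Rightarrow> real"
  assumes "N \<ge> 1"
  shows "(\<Sum>k = 1..N. L k - Q k) = L 1 - Q N + (\<Sum>k = 1..<N. L (k + 1) - Q k)"
proof -
  have "(\<Sum>k = 1..N. L k) = L 1 + (\<Sum>k = Suc 1..N. L k)"
    by (rule sum.atLeast_Suc_atMost[OF assms])
  moreover have "(\<Sum>k = Suc 1..N. L k) = (\<Sum>k = 1..<N. L (k + 1))"
    by (simp only: sum.shift_bounds_Suc_ivl Suc_eq_plus1[symmetric]
        flip: atLeastLessThanSuc_atLeastAtMost)
  moreover have "(\<Sum>k = 1..N. Q k) = Q N + (\<Sum>k = 1..<N. Q k)"
    by (rule sum.last_plus[OF assms])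
  ultimately show ?thesis
    by (simp add: sum_subtractf)
qed

section \<open>The multi-element scheme\<close>

locale sbp_mesh =
  fixes N :: nat and x :: "nat \<Rightarrow> real" and a :: "real \<Rightarrow> real"
    and S :: "nat \<Rightarrow> sbp_op" and q r :: "nat \<Rightarrow> nat" and av :: "nat \<Rightarrow> real vec"
  assumes N: "N \<ge> 1"
    and sbp: "\<And>k. k \<in> {1..N} \<Longrightarrow> sbp_discretisation (q k) (r k) (x (k - 1)) (x k) (S k)"
    and av: "\<And>k. k \<in> {1..N} \<Longrightarrow> av k \<in> carrier_vec (sbp_dim (S k))"
    and exact: "left_val (S 1) (av 1) = a (x 0)" "right_val (S N) (av N) = a (x N)"
begin

lemma element: "k \<in> {1..N} \<Longrightarrow> sbp_element (q k) (r k) (x (k - 1)) (x k) (S k)"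
  by unfold_locales (rule sbp)

lemma elem_flux_simps:
  "elem_flux N S av \<phi> g w k \<in> carrier_vec 2"
  "elem_flux N S av \<phi> g w k $ 0 = num_flux N S av \<phi> g w (k - 1)"
  "elem_flux N S av \<phi> g w k $ 1 = num_flux N S av \<phi> g w k"
  unfolding elem_flux_def by (rule carrier_vecI) simp_all

text \<open>Adjacent elements share the flux at their common end point, so whatever flux is chosen there,
  the rates \<open>f\<^bsub>k-1\<^esub> - f\<^bsub>k\<^esub>\<close> of the elements telescope.\<close>

lemma conservative: "conservative N x a S av \<phi>"
  unfolding conservative_def Let_def
proof (intro allI impI ballI conjI)
  fix T g u t k
  assume sol: "solves_semidisc N S av \<phi> g T u" and t: "t \<in> T"
  let ?F = "num_flux N S av \<phi> (g t) (\<lambda>j. u j t)"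
  let ?f = "elem_flux N S av \<phi> (g t) (\<lambda>j. u j t)"
  have flux: "- (ones_vec (sbp_dim (S k)) \<bullet> (transpose_mat (sbp_R (S k)) *\<^sub>v (bnd_mat *\<^sub>v ?f k)))
      = ?F (k - 1) - ?F k" if k: "k \<in> {1..N}" for k
  proof -
    interpret E: sbp_element "q k" "r k" "x (k - 1)" "x k" "S k"
      by (rule element[OF k])
    have "ones_vec (sbp_dim (S k)) \<in> carrier_vec (sbp_dim (S k))"
      by (simp add: ones_vec_def)
    from E.boundary_term[OF this elem_flux_simps(1)] show ?thesis
      by (simp only: E.boundary_vals_ones elem_flux_simps)
  qed
  have deriv: "((\<lambda>s. ones_vec (sbp_dim (S k)) \<bullet> (sbp_M (S k) *\<^sub>v u k s)) has_real_derivative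
      ?F (k - 1) - ?F k) (at t within T)" if k: "k \<in> {1..N}" for k
  proof -
    interpret E: sbp_element "q k" "r k" "x (k - 1)" "x k" "S k"
      by (rule element[OF k])
    have uc: "\<And>s. s \<in> T \<Longrightarrow> u k s \<in> carrier_vec (sbp_dim (S k))"
      using sol k unfolding solves_semidisc_def by blast
    let ?u' = "semidisc_rhs (S k) (av k) (u k t) (?f k)"
    have u': "?u' \<in> carrier_vec (sbp_dim (S k))"
      by (intro E.semidisc_rhs_carrier av k uc t elem_flux_simps)
    have "((\<lambda>s. ones_vec (sbp_dim (S k)) \<bullet> (sbp_M (S k) *\<^sub>v u k s)) has_real_derivative
        0\<^sub>v (sbp_dim (S k)) \<bullet> (sbp_M (S k) *\<^sub>v u k t) + ones_vec (sbp_dim (S k)) \<bullet> (sbp_M (S k) *\<^sub>v ?u'))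
        (at t within T)"
    proof (rule has_real_derivative_scalar_prod_mult_mat_vec[OF E.carriers(2) uc u'])
      show "((\<lambda>s. u k s $ j) has_real_derivative ?u' $ j) (at t within T)" if "j < sbp_dim (S k)" for j
        using sol k t that unfolding solves_semidisc_def by blast
    qed (use t in \<open>simp_all add: ones_vec_def\<close>)
    moreover have "0\<^sub>v (sbp_dim (S k)) \<bullet> (sbp_M (S k) *\<^sub>v u k t) = 0"
      using E.carriers uc[OF t] by (intro scalar_prod_left_zero) simp
    ultimately show ?thesis
      by (simp only: E.semidisc_mass_rate[OF av[OF k] uc[OF t] elem_flux_simps(1)]
          elem_flux_simps add_0)
  qed
  show "- (ones_vec (sbp_dim (S k)) \<bullet> (transpose_mat (sbp_R (S k)) *\<^sub>v (bnd_mat *\<^sub>v ?f k)))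
      = ?F (k - 1) - ?F k" if "k \<in> {1..N}"
    using flux that .
  then show "((\<lambda>s. ones_vec (sbp_dim (S k)) \<bullet> (sbp_M (S k) *\<^sub>v u k s)) has_real_derivative
      - (ones_vec (sbp_dim (S k)) \<bullet> (transpose_mat (sbp_R (S k)) *\<^sub>v (bnd_mat *\<^sub>v ?f k))))
      (at t within T)" if "k \<in> {1..N}"
    using deriv that by simp
  have "((\<lambda>s. \<Sum>k = 1..N. ones_vec (sbp_dim (S k)) \<bullet> (sbp_M (S k) *\<^sub>v u k s))
      has_real_derivative (\<Sum>k = 1..N. ?F (k - 1) - ?F k)) (at t within T)"
    by (intro DERIV_sum deriv)
  moreover have "(\<Sum>k = 1..n. G (k - 1) - G k) = G 0 - G n" for G :: "nat \<Rightarrow> real" and n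
    by (induction n) simp_all
  ultimately show "((\<lambda>s. \<Sum>k = 1..N. ones_vec (sbp_dim (S k)) \<bullet> (sbp_M (S k) *\<^sub>v u k s))
      has_real_derivative ?F 0 - ?F N) (at t within T)"
    by simp
  show "?F 0 - ?F N = a (x 0) * g t - a (x N) * right_val (S N) (u N t)"
    using N exact by (simp add: num_flux_def)
qed

text \<open>The energy rate splits into one boundary term for each mesh point; each of them can be
  estimated separately, and an interior one is the interior energy rate of its flux.\<close>

lemma energy_stable:
  assumes a0: "a (x 0) \<ge> 0"
    and dissip: "\<And>k um up. k \<in> {1..<N} \<Longrightarrow>
      interior_energy_rate (\<phi> k) (right_val (S k) (av k)) (left_val (S (k + 1)) (av (k + 1))) um up \<le> 0"
  shows "energy_stable N x a S av \<phi>"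
  unfolding energy_stable_def
proof (intro allI impI ballI exI conjI)
  fix T g u t
  assume sol: "solves_semidisc N S av \<phi> g T u" and t: "t \<in> T"
  let ?F = "num_flux N S av \<phi> (g t) (\<lambda>j. u j t)"
  let ?f = "elem_flux N S av \<phi> (g t) (\<lambda>j. u j t)"
  define V where "V k = u k t \<bullet> (transpose_mat (mult_op (u k t)) *\<^sub>v
    (sbp_M (S k) *\<^sub>v (sbp_D (S k) *\<^sub>v av k)))" for k
  define L where "L k = 2 * left_val (S k) (u k t) * ?F (k - 1)
    - left_val (S k) (av k) * (left_val (S k) (u k t))\<^sup>2" for k
  define Q where "Q k = 2 * right_val (S k) (u k t) * ?F k
    - right_val (S k) (av k) * (right_val (S k) (u k t))\<^sup>2" for k
  have deriv: "((\<lambda>s. u k s \<bullet> (sbp_M (S k) *\<^sub>v u k s)) has_real_derivative - V k + (L k - Q k))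
      (at t within T)" if k: "k \<in> {1..N}" for k
  proof -
    interpret E: sbp_element "q k" "r k" "x (k - 1)" "x k" "S k"
      by (rule element[OF k])
    have uc: "\<And>s. s \<in> T \<Longrightarrow> u k s \<in> carrier_vec (sbp_dim (S k))"
      using sol k unfolding solves_semidisc_def by blast
    let ?u' = "semidisc_rhs (S k) (av k) (u k t) (?f k)"
    have u': "?u' \<in> carrier_vec (sbp_dim (S k))"
      by (intro E.semidisc_rhs_carrier av k uc t elem_flux_simps)
    have du: "((\<lambda>s. u k s $ j) has_real_derivative ?u' $ j) (at t within T)" if "j < sbp_dim (S k)" for j
      using sol k t that unfolding solves_semidisc_def by blast
    have "((\<lambda>s. u k s \<bullet> (sbp_M (S k) *\<^sub>v u k s)) has_real_derivative
        ?u' \<bullet> (sbp_M (S k) *\<^sub>v u k t) + u k t \<bullet> (sbp_M (S k) *\<^sub>v ?u')) (at t within T)"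
      by (rule has_real_derivative_scalar_prod_mult_mat_vec[OF E.carriers(2) uc u' du du t])
    moreover have "?u' \<bullet> (sbp_M (S k) *\<^sub>v u k t) + u k t \<bullet> (sbp_M (S k) *\<^sub>v ?u') = - V k + (L k - Q k)"
      using E.semidisc_energy_rate[OF av[OF k] uc[OF t] elem_flux_simps(1),
          of \<phi> "g t" "\<lambda>j. u j t" k]
        E.M_symmetric[OF u' uc[OF t]]
      unfolding V_def L_def Q_def by (simp only: elem_flux_simps)
    ultimately show ?thesis by simp
  qed
  show "((\<lambda>s. \<Sum>k = 1..N. u k s \<bullet> (sbp_M (S k) *\<^sub>v u k s)) has_real_derivative
      (\<Sum>k = 1..N. - V k + (L k - Q k))) (at t within T)"
    by (intro DERIV_sum deriv) simp
  have inflow: "L 1 \<le> a (x 0) * (g t)\<^sup>2"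
  proof -
    \<comment> \<open>Young's inequality \<open>2 g u\<^sub>L \<le> g\<^sup>2 + u\<^sub>L\<^sup>2\<close>, weighted with the inflow speed.\<close>
    have "0 \<le> a (x 0) * (left_val (S 1) (u 1 t) - g t)\<^sup>2"
      using a0 by simp
    then show ?thesis
      using exact by (simp add: L_def num_flux_def power2_eq_square algebra_simps)
  qed
  have outflow: "Q N = a (x N) * (right_val (S N) (u N t))\<^sup>2"
    using N exact by (simp add: Q_def num_flux_def power2_eq_square algebra_simps)
  have interior: "L (k + 1) - Q k \<le> 0" if k: "k \<in> {1..<N}" for k
  proof -
    have "L (k + 1) - Q k = interior_energy_rate (\<phi> k) (right_val (S k) (av k))
        (left_val (S (k + 1)) (av (k + 1))) (right_val (S k) (u k t)) (left_val (S (k + 1)) (u (k + 1) t))"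
      using k by (simp add: L_def Q_def num_flux_def interior_energy_rate_def algebra_simps)
    then show ?thesis using dissip[OF k] by simp
  qed
  have "(\<Sum>k = 1..N. - V k + (L k - Q k)) = (\<Sum>k = 1..N. L k - Q k) - (\<Sum>k = 1..N. V k)"
    by (simp add: sum_subtractf)
  also have "(\<Sum>k = 1..N. L k - Q k) = L 1 - Q N + (\<Sum>k = 1..<N. L (k + 1) - Q k)"
    by (rule sum_left_minus_right[OF N])
  also have "\<dots> \<le> a (x 0) * (g t)\<^sup>2 - a (x N) * (right_val (S N) (u N t))\<^sup>2"
  proof -
    have "(\<Sum>k = 1..<N. L (k + 1) - Q k) \<le> 0"
      by (intro sum_nonpos interior)
    then show ?thesis
      using inflow outflow by linarith
  qed
  finally show "(\<Sum>k = 1..N. - V k + (L k - Q k)) \<le>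
      a (x 0) * (g t)\<^sup>2 - a (x N) * (right_val (S N) (u N t))\<^sup>2
      - (\<Sum>k = 1..N. u k t \<bullet> (transpose_mat (mult_op (u k t)) *\<^sub>v
          (sbp_M (S k) *\<^sub>v (sbp_D (S k) *\<^sub>v av k))))"
    by (simp add: V_def)
qed

end

section \<open>Edge based and split fluxes\<close>

lemma edge_upwind_eq_split_upwind_iff:
  "edge_upwind s = split_upwind am ap \<longleftrightarrow> s = am"
proof
  assume "edge_upwind s = split_upwind am ap"
  from fun_cong[OF fun_cong[OF this, of 1], of 0] show "s = am"
    by (simp add: edge_upwind_def split_upwind_def)
qed (simp add: edge_upwind_def split_upwind_def fun_eq_iff)

lemma edge_central_eq_split_central_iff:
  "edge_central s = split_central am ap \<longleftrightarrow> s = am \<and> s = ap"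
proof
  assume *: "edge_central s = split_central am ap"
  from fun_cong[OF fun_cong[OF *, of 1], of 0] fun_cong[OF fun_cong[OF *, of 0], of 1]
  show "s = am \<and> s = ap"
    by (simp add: edge_central_def split_central_def)
qed (auto simp: edge_central_def split_central_def fun_eq_iff algebra_simps)

theorem theorem5:
  fixes N :: nat and x :: "nat \<Rightarrow> real" and xL xR :: real
    and a :: "real \<Rightarrow> real"
    and S :: "nat \<Rightarrow> sbp_op" and q r :: "nat \<Rightarrow> nat"
    and av :: "nat \<Rightarrow> real vec"
    and aL aR :: "nat \<Rightarrow> real"
  assumes N: "N \<ge> 1"
    and mesh: "x 0 = xL" "x N = xR" "\<And>k. k < N \<Longrightarrow> x k < x (k + 1)"
    and a_pos: "\<And>y. y \<in> {xL..xR} \<Longrightarrow> a y > 0"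
    and sbp: "\<And>k. k \<in> {1..N} \<Longrightarrow> sbp_discretisation (q k) (r k) (x (k - 1)) (x k) (S k)"
    and av: "\<And>k. k \<in> {1..N} \<Longrightarrow> av k \<in> carrier_vec (sbp_dim (S k))"
    and aL: "\<And>k. aL k = left_val (S k) (av k)"
    and aR: "\<And>k. aR k = right_val (S k) (av k)"
    and bnd_pos: "\<And>k. k \<in> {1..N} \<Longrightarrow> aL k > 0 \<and> aR k > 0"
    and cont: "\<And>k. k \<in> {1..<N} \<Longrightarrow> aR k = aL (k + 1)"
    and exact: "aL 1 = a xL" "aR N = a xR"
  shows
    \<comment> \<open>Exterior boundaries: the edge based and the split upwind flux agree.\<close>
    "(\<forall>ap. edge_upwind (a xL) = split_upwind (aL 1) ap) \<and>
     (\<forall>ap. edge_upwind (a xR) = split_upwind (aR N) ap) \<and>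
     \<comment> \<open>Interior boundaries: the fluxes agree for the single-valued discretised speed, and for
        \<open>a (x k)\<close> exactly when it is the value of the discretised speed.\<close>
     (\<forall>k \<in> {1..<N}. \<forall>s \<in> {aR k, aL (k + 1)}.
        edge_central s = split_central (aR k) (aL (k + 1)) \<and>
        edge_upwind s = split_upwind (aR k) (aL (k + 1))) \<and>
     (\<forall>k \<in> {1..<N}.
        (edge_central (a (x k)) = split_central (aR k) (aL (k + 1)) \<longleftrightarrow> a (x k) = aR k) \<and>
        (edge_upwind (a (x k)) = split_upwind (aR k) (aL (k + 1)) \<longleftrightarrow> a (x k) = aR k)) \<and>
     \<comment> \<open>Upwind flux at the exterior, upwind or central flux at each interior boundary.\<close>
     (\<forall>\<phi>. (\<forall>k \<in> {1..<N}. \<phi> k \<in> {split_upwind, split_central}) \<longrightarrow>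
        conservative N x a S av \<phi> \<and> energy_stable N x a S av \<phi>) \<and>
     (\<forall>k \<in> {1..<N}. \<forall>um up.
        interior_energy_rate split_upwind (aR k) (aL (k + 1)) um up \<le> 0 \<and>
        interior_energy_rate split_central (aR k) (aL (k + 1)) um up = 0)"
proof -
  have "left_val (S 1) (av 1) = a (x 0)" "right_val (S N) (av N) = a (x N)"
    using exact by (simp_all only: aL aR mesh(1,2))
  then interpret mesh: sbp_mesh N x a S q r av
    by (intro sbp_mesh.intro N sbp av)
  have upwind: "interior_energy_rate split_upwind (aR k) (aL (k + 1)) um up \<le> 0"
    if "k \<in> {1..<N}" for k um up
  proof -
    have "aR k > 0"
      using that bnd_pos[of k] by simp
    then show ?thesis
      by (simp add: cont[OF that, symmetric] interior_energy_rate_split_upwind del: One_nat_def)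
  qed
  have central: "interior_energy_rate split_central (aR k) (aL (k + 1)) um up = 0"
    if "k \<in> {1..<N}" for k um up
    using cont[OF that] by (metis interior_energy_rate_split_central)
  have "a (x 0) > 0"
    using exact(1) bnd_pos[of 1] N mesh(1) by simp
  then have stable: "energy_stable N x a S av \<phi>"
    if "\<forall>k \<in> {1..<N}. \<phi> k \<in> {split_upwind, split_central}" for \<phi>
  proof (intro mesh.energy_stable)
    fix k um up
    assume k: "k \<in> {1..<N}"
    then have "\<phi> k = split_upwind \<or> \<phi> k = split_central"
      using that by blast
    then show "interior_energy_rate (\<phi> k) (right_val (S k) (av k))
        (left_val (S (k + 1)) (av (k + 1))) um up \<le> 0"
      using upwind[OF k, of um up] central[OF k, of um up] unfolding aL aR by (elim disjE) simp_all
  qed simp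
  show ?thesis
    unfolding edge_upwind_eq_split_upwind_iff edge_central_eq_split_central_iff
    using exact cont upwind central stable mesh.conservative by auto
qed

end
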